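(* Let $T\subset\mathbb{R}^3$ be a non-degenerate tetrahedron, $k\ge1$, and let $U\in\Pi_k(T;\mathbb{R}^{3\times3})$ be such that all of the degrees of freedom of the $k$th-order $H(\operatorname{sym}\operatorname{Curl})$ finite element on $T$, i.e. all degrees of freedom of types (1a), (1b), (1c), (2a), (2b), (2c), (3a), (3b), (4) listed in the context, are zero for $U$. Then $U\equiv0$.
   Context: $\Pi_k(T;\mathbb{R}^{3\times3})$ is the space of $\mathbb{R}^{3\times3}$-valued polynomials of (total) degree $k$ or less on $T$. Lagrange points on $T$ are the usual ones: the points with barycentric coordinates in $\frac1k\mathbb{Z}_{\ge 0}$ with respect to $T$. An inner Lagrange point of an edge/face/of $T$ is one in the relative interior of that edge/face/of $T$. Each face of $T$ has a fixed unit normal $\mathbf{n}$ (arbitrary orientation). Each edge $E$ has a fixed unit tangent $\mathbf{t}_E$ and two fixed unit vectors $\mathbf{n}_{E,1},\mathbf{n}_{E,2}$ that span the plane orthogonal to $E$. For a face $F_i$ with normal $\mathbf{n}_i$ containing the edge $E$, the conormal is $\boldsymbol{\partial}_i:=\mathbf{t}_E\times\mathbf{n}_i$, so $\mathbf{t}_E=\mathbf{n}_i\times\boldsymbol{\partial}_i$. For each face with normal $\mathbf{n}$, two vectors $\mathbf{a}_1,\mathbf{a}_2$ are fixed such that $\mathbf{a}_1,\mathbf{a}_2,\mathbf{n}$ are linearly independent. The degrees of freedom are the following linear functionals of $U$. (1) For each vertex $V$ of $T$: (1a) $U(V)_{ij}$ for $i,j\in\{1,2,3\}$, $i\ne j$;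 (1b) $U(V)_{11}-U(V)_{22}$ and $U(V)_{22}-U(V)_{33}$; (1c) $U(V)_{11}+U(V)_{22}+U(V)_{33}$. (2) If $k\ge2$, for each edge $E$ of $T$ and each inner Lagrange point $L$ on $E$: (2a) $\mathbf{n}_{E,1}^TU(L)\mathbf{t}_E$ and $\mathbf{n}_{E,2}^TU(L)\mathbf{t}_E$; (2b) for each of the two faces $F_i$, $i=1,2$, of $T$ adjacent to $E$: $\mathbf{t}_E^TU(L)(\mathbf{n}_i\times\mathbf{t}_E)$, $\mathbf{n}_i^TU(L)(\mathbf{n}_i\times\mathbf{t}_E)$, and $\mathbf{t}_E^TU(L)(\mathbf{n}_i\times\boldsymbol{\partial}_i)+\boldsymbol{\partial}_i^TU(L)(\mathbf{n}_i\times\mathbf{t}_E)$; (2c) $\mathbf{t}_E^TU(L)\mathbf{t}_E$. (3) If $k\ge3$, for each face $F$ of $T$ with normal $\mathbf{n}$ and vectors $\mathbf{a}_1,\mathbf{a}_2$, and each inner Lagrange point $L$ of $F$: (3a) $\mathbf{a}_1^TU(L)(\mathbf{n}\times\mathbf{a}_1)$, $\mathbf{a}_2^TU(L)(\mathbf{n}\times\mathbf{a}_2)$, $\mathbf{a}_1^TU(L)(\mathbf{n}\times\mathbf{a}_2)+\mathbf{a}_2^TU(L)(\mathbf{n}\times\mathbf{a}_1)$, $\mathbf{n}^TU(L)(\mathbf{n}\times\mathbf{a}_1)$, $\mathbf{n}^TU(L)(\mathbf{n}\times\mathbf{a}_2)$; (3b) $\mathbf{a}_1^TU(L)(\mathbf{n}\times\mathbf{a}_2)-\mathbf{a}_2^TU(L)(\mathbf{n}\times\mathbf{a}_1)$,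 $\mathbf{a}_1^TU(L)\mathbf{n}$, $\mathbf{a}_2^TU(L)\mathbf{n}$, $\mathbf{n}^TU(L)\mathbf{n}$. (4) If $k\ge4$, for each inner Lagrange point $L$ of $T$: the nine entries of $U(L)$. *)

theory Defs
  imports "HOL-Analysis.Analysis"
begin

text \<open>
  Only the values on \<open>T\<close> are constrained: a member of \<open>matrix_polys k T\<close> represents a polynomial
  on \<open>T\<close>, and its values off \<open>T\<close> are irrelevant. The sum runs over the multi-indices of total
  degree at most \<open>k\<close>.
\<close>

definition matrix_polys :: "nat \<Rightarrow> (real^3) set \<Rightarrow> (real^3 \<Rightarrow> real^3^3) set" where
  "matrix_polys k T = {U. \<exists>C :: (3 \<Rightarrow> nat) \<Rightarrow> real^3^3. \<forall>x\<in>T.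
     U x = (\<Sum>\<alpha> | (\<Sum>i\<in>UNIV. \<alpha> i) \<le> k. (\<Prod>i\<in>UNIV. x $ i ^ \<alpha> i) *\<^sub>R C \<alpha>)}"

lemma finite_multi_indices: "finite {\<alpha> :: 3 \<Rightarrow> nat. (\<Sum>i\<in>UNIV. \<alpha> i) \<le> k}"
proof (rule finite_subset)
  show "{\<alpha> :: 3 \<Rightarrow> nat. (\<Sum>i\<in>UNIV. \<alpha> i) \<le> k} \<subseteq> (\<Pi>\<^sub>E i\<in>UNIV. {..k})"
  proof
    fix \<alpha> :: "3 \<Rightarrow> nat"
    assume "\<alpha> \<in> {\<alpha>. (\<Sum>i\<in>UNIV. \<alpha> i) \<le> k}"
    moreover have "\<alpha> i \<le> (\<Sum>i\<in>UNIV. \<alpha> i)" for i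
      by (rule member_le_sum) auto
    ultimately show "\<alpha> \<in> (\<Pi>\<^sub>E i\<in>UNIV. {..k})"
      by (auto intro: order_trans)
  qed
  show "finite (\<Pi>\<^sub>E i\<in>(UNIV :: 3 set). {..k})"
    by (rule finite_PiE) auto
qed

text \<open>
  For a simplex \<open>T\<close> the extreme points are the vertices, so \<open>m V / k\<close> is the barycentric
  coordinate belonging to \<open>V\<close>.
\<close>

definition lagrange_points :: "nat \<Rightarrow> (real^3) set \<Rightarrow> (real^3) set" where
  "lagrange_points k T =
     {\<Sum>V | V extreme_point_of T. (real (m V) / real k) *\<^sub>R V | m :: real^3 \<Rightarrow> nat.
        (\<Sum>V | V extreme_point_of T. real (m V) / real k) = 1}"

text \<open>\<open>S\<close> is an edge or a face of \<open>T\<close>, or \<open>T\<close> itself.\<close>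

definition inner_lagrange_points :: "nat \<Rightarrow> (real^3) set \<Rightarrow> (real^3) set \<Rightarrow> (real^3) set" where
  "inner_lagrange_points k T S = lagrange_points k T \<inter> rel_interior S"

definition unit_normal :: "(real^3) set \<Rightarrow> real^3 \<Rightarrow> bool" where
  "unit_normal F n \<longleftrightarrow> norm n = 1 \<and> (\<forall>x\<in>F. \<forall>y\<in>F. n \<bullet> (x - y) = 0)"

definition unit_tangent :: "(real^3) set \<Rightarrow> real^3 \<Rightarrow> bool" where
  "unit_tangent E t \<longleftrightarrow> norm t = 1 \<and> (\<exists>x\<in>E. \<exists>y\<in>E. \<exists>c. t = c *\<^sub>R (x - y))"

definition edge_normals :: "(real^3) set \<Rightarrow> real^3 \<Rightarrow> real^3 \<Rightarrow> bool" where
  "edge_normals E m1 m2 \<longleftrightarrow> norm m1 = 1 \<and> norm m2 = 1 \<and>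
     span {m1, m2} = {v. \<forall>x\<in>E. \<forall>y\<in>E. v \<bullet> (x - y) = 0}"

text \<open>Distinctness is needed because \<open>independent\<close> speaks about a set, not about a family.\<close>

definition face_frame :: "real^3 \<Rightarrow> real^3 \<Rightarrow> real^3 \<Rightarrow> bool" where
  "face_frame a1 a2 n \<longleftrightarrow> distinct [a1, a2, n] \<and> independent {a1, a2, n}"

definition conormal :: "real^3 \<Rightarrow> real^3 \<Rightarrow> real^3" where
  "conormal t n = cross3 t n"

definition bil :: "real^3 \<Rightarrow> real^3^3 \<Rightarrow> real^3 \<Rightarrow> real" where
  "bil x A y = x \<bullet> (A *v y)"

definition vertex_dofs :: "(real^3) set \<Rightarrow> ((real^3 \<Rightarrow> real^3^3) \<Rightarrow> real) set" where
  "vertex_dofs T = (\<Union>V\<in>{V. V extreme_point_of T}.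
     {\<lambda>U. U V $ i $ j | i j. i \<noteq> j}
     \<union> {\<lambda>U. U V $ 1 $ 1 - U V $ 2 $ 2, \<lambda>U. U V $ 2 $ 2 - U V $ 3 $ 3}
     \<union> {\<lambda>U. U V $ 1 $ 1 + U V $ 2 $ 2 + U V $ 3 $ 3})"

text \<open>
  Below, \<open>n F\<close> is the chosen normal of the face \<open>F\<close>, \<open>a1 F\<close> and \<open>a2 F\<close> its auxiliary vectors,
  \<open>t E\<close> the chosen tangent of the edge \<open>E\<close>, and \<open>m1 E\<close>, \<open>m2 E\<close> its two chosen normals.
\<close>

definition edge_dofs ::
  "nat \<Rightarrow> (real^3) set \<Rightarrow> ((real^3) set \<Rightarrow> real^3) \<Rightarrow> ((real^3) set \<Rightarrow> real^3)
    \<Rightarrow> ((real^3) set \<Rightarrow> real^3) \<Rightarrow> ((real^3) set \<Rightarrow> real^3)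
    \<Rightarrow> ((real^3 \<Rightarrow> real^3^3) \<Rightarrow> real) set" where
  "edge_dofs k T n t m1 m2 =
    (if k \<ge> 2 then
       (\<Union>E\<in>{E. E edge_of T}. \<Union>L\<in>inner_lagrange_points k T E.
          {\<lambda>U. bil (m1 E) (U L) (t E), \<lambda>U. bil (m2 E) (U L) (t E)}
          \<union> (\<Union>F\<in>{F. F facet_of T \<and> E \<subseteq> F}.
               {\<lambda>U. bil (t E) (U L) (cross3 (n F) (t E)),
                \<lambda>U. bil (n F) (U L) (cross3 (n F) (t E)),
                \<lambda>U. bil (t E) (U L) (cross3 (n F) (conormal (t E) (n F)))
                     + bil (conormal (t E) (n F)) (U L) (cross3 (n F) (t E))})
          \<union> {\<lambda>U. bil (t E) (U L) (t E)})
     else {})"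

definition face_dofs ::
  "nat \<Rightarrow> (real^3) set \<Rightarrow> ((real^3) set \<Rightarrow> real^3) \<Rightarrow> ((real^3) set \<Rightarrow> real^3)
    \<Rightarrow> ((real^3) set \<Rightarrow> real^3) \<Rightarrow> ((real^3 \<Rightarrow> real^3^3) \<Rightarrow> real) set" where
  "face_dofs k T n a1 a2 =
    (if k \<ge> 3 then
       (\<Union>F\<in>{F. F facet_of T}. \<Union>L\<in>inner_lagrange_points k T F.
          {\<lambda>U. bil (a1 F) (U L) (cross3 (n F) (a1 F)),
           \<lambda>U. bil (a2 F) (U L) (cross3 (n F) (a2 F)),
           \<lambda>U. bil (a1 F) (U L) (cross3 (n F) (a2 F)) + bil (a2 F) (U L) (cross3 (n F) (a1 F)),
           \<lambda>U. bil (n F) (U L) (cross3 (n F) (a1 F)),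
           \<lambda>U. bil (n F) (U L) (cross3 (n F) (a2 F))}
          \<union>
          {\<lambda>U. bil (a1 F) (U L) (cross3 (n F) (a2 F)) - bil (a2 F) (U L) (cross3 (n F) (a1 F)),
           \<lambda>U. bil (a1 F) (U L) (n F),
           \<lambda>U. bil (a2 F) (U L) (n F),
           \<lambda>U. bil (n F) (U L) (n F)})
     else {})"

definition interior_dofs :: "nat \<Rightarrow> (real^3) set \<Rightarrow> ((real^3 \<Rightarrow> real^3^3) \<Rightarrow> real) set" where
  "interior_dofs k T =
    (if k \<ge> 4 then (\<Union>L\<in>inner_lagrange_points k T T. {\<lambda>U. U L $ i $ j | i j. True}) else {})"

definition symcurl_dofs ::
  "nat \<Rightarrow> (real^3) set \<Rightarrow> ((real^3) set \<Rightarrow> real^3) \<Rightarrow> ((real^3) set \<Rightarrow> real^3)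
    \<Rightarrow> ((real^3) set \<Rightarrow> real^3) \<Rightarrow> ((real^3) set \<Rightarrow> real^3)
    \<Rightarrow> ((real^3) set \<Rightarrow> real^3) \<Rightarrow> ((real^3) set \<Rightarrow> real^3)
    \<Rightarrow> ((real^3 \<Rightarrow> real^3^3) \<Rightarrow> real) set" where
  "symcurl_dofs k T n a1 a2 t m1 m2 =
     vertex_dofs T \<union> edge_dofs k T n t m1 m2 \<union> face_dofs k T n a1 a2 \<union> interior_dofs k T"

end

theory Submission
  imports Defs
begin

text \<open>
  Each functional depends only on the value of \<open>U\<close> at one Lagrange point, and at every Lagrange point
  \<open>L\<close> the functionals together determine the matrix \<open>U L\<close>. Hence the claim splits into two independent parts.

  Pointwise part. The vertices with positive barycentric coordinate at \<open>L\<close> span the unique face of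
  \<open>T\<close> that has \<open>L\<close> in its relative interior (\<open>lagrange_point_support\<close>): a vertex, an edge, a facet
  or \<open>T\<close>. At vertices and in the interior the functionals give the entries of \<open>U L\<close>, up to an
  invertible combination of the diagonal ones. On a facet with normal \<open>n\<close> they make \<open>U L\<close> kill \<open>n\<close>
  and the vectors \<open>n \<times> a\<close>, with \<open>a\<close> one of the two auxiliary vectors (\<open>face_point_determined\<close>). On an
  edge with tangent \<open>t\<close> they make it kill \<open>t\<close> and the vectors \<open>n \<times> t\<close>, with \<open>n\<close> the normal of one of
  the two adjacent faces (\<open>edge_point_determined\<close>). In both cases these are three linearly
  independent vectors; on an edge this is so because the two face normals are not parallel
  (\<open>facet_normals_not_parallel\<close>).

  Interpolation part. A polynomial of degree at most \<open>k\<close> that vanishes at the Lagrange points of order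
  \<open>k\<close> of a simplex is zero (\<open>lagrange_unisolvence\<close>). Instead of a dimension count or a basis of
  Lagrange polynomials, the proof takes finite differences along the lattice directions
  (\<open>polynomial_eq_0_on_lattice\<close>): a difference has degree at most \<open>k - 1\<close> and vanishes on the
  lattice simplex of size \<open>k - 1\<close>, so by induction it is zero. A polynomial that is periodic in
  directions which span the space is constant.

  The second part is applied to each entry of \<open>U\<close>.
\<close>

section \<open>Bounding the degree by finite differences\<close>

text \<open>
  On polynomial functions over \<open>\<real>\<close> this is the usual bound on the total degree, as a difference lowers
  the degree of a nonconstant polynomial by at least one. This form of the bound mentions no coordinates, so it
  serves the monomials in Cartesian coordinates and the lattice directions of a simplex alike.
\<close>

primrec diff_degree_le :: "nat \<Rightarrow> ('a::ab_group_add \<Rightarrow> 'b::ab_group_add) \<Rightarrow> bool" where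
  "diff_degree_le 0 f \<longleftrightarrow> (\<exists>c. \<forall>x. f x = c)"
| "diff_degree_le (Suc k) f \<longleftrightarrow> (\<forall>d. diff_degree_le k (\<lambda>x. f (x + d) - f x))"

lemma diff_degree_le_const: "diff_degree_le k (\<lambda>x. c)"
  by (induction k arbitrary: c) auto

lemma diff_degree_le_Suc: "diff_degree_le k f \<Longrightarrow> diff_degree_le (Suc k) f"
proof (induction k arbitrary: f)
  case 0
  then obtain c where "\<And>x. f x = c" by auto
  then show ?case by simp
next
  case (Suc k)
  show ?case
    unfolding diff_degree_le.simps(2)[of "Suc k" f]
  proof
    fix d
    have "diff_degree_le k (\<lambda>x. f (x + d) - f x)" using Suc.prems by simp
    then show "diff_degree_le (Suc k) (\<lambda>x. f (x + d) - f x)" by (rule Suc.IH)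
  qed
qed

lemma diff_degree_le_mono:
  assumes "diff_degree_le k f" "k \<le> l"
  shows "diff_degree_le l f"
  using assms(2,1) by (induction rule: dec_induct) (assumption, rule diff_degree_le_Suc)

lemma diff_degree_le_add:
  "diff_degree_le k f \<Longrightarrow> diff_degree_le k g \<Longrightarrow> diff_degree_le k (\<lambda>x. f x + g x)"
proof (induction k arbitrary: f g)
  case 0
  then obtain a b where "\<And>x. f x = a" "\<And>x. g x = b" by auto
  then show ?case by simp
next
  case (Suc k)
  have "diff_degree_le k (\<lambda>x. (f (x + d) - f x) + (g (x + d) - g x))" for d
    using Suc.prems by (intro Suc.IH) auto
  then show ?case by (simp add: add_diff_add)
qed

lemma diff_degree_le_sum:
  assumes "\<And>i. i \<in> I \<Longrightarrow> diff_degree_le k (f i)"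
  shows "diff_degree_le k (\<lambda>x. \<Sum>i\<in>I. f i x)"
  using assms
  by (induction I rule: infinite_finite_induct)
     (simp_all add: diff_degree_le_const diff_degree_le_add)

lemma diff_degree_le_shift: "diff_degree_le k f \<Longrightarrow> diff_degree_le k (\<lambda>x. f (x + e))"
proof (induction k arbitrary: f)
  case 0
  then obtain c where "\<And>x. f x = c" by auto
  then show ?case by simp
next
  case (Suc k)
  have "diff_degree_le k (\<lambda>x. f (x + e + d) - f (x + e))" for d
    using Suc.IH[of "\<lambda>x. f (x + d) - f x"] Suc.prems by simp
  then show ?case by (simp add: add.assoc add.commute[of e])
qed

text \<open>
  This rests on the product rule
  \<open>f (x + d) g (x + d) - f x g x = (f (x + d) - f x) g (x + d) + f x (g (x + d) - g x)\<close>,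
  in which each summand has one factor of lower degree, and on the invariance of degree under the
  shift in \<open>g (x + d)\<close>.
\<close>

lemma diff_degree_le_mult:
  fixes f g :: "'a::ab_group_add \<Rightarrow> 'b::ring"
  assumes "diff_degree_le k f" "diff_degree_le l g"
  shows "diff_degree_le (k + l) (\<lambda>x. f x * g x)"
  using assms
proof (induction "k + l" arbitrary: k l f g)
  case 0
  then obtain a b where "\<And>x. f x = a" "\<And>x. g x = b" by auto
  then show ?case using 0 by simp
next
  case (Suc n)
  have "diff_degree_le n (\<lambda>x. f (x + d) * g (x + d) - f x * g x)" for d
  proof -
    have 1: "diff_degree_le n (\<lambda>x. (f (x + d) - f x) * g (x + d))"
    proof (cases k)
      case 0
      then obtain c where "\<And>x. f x = c" using Suc.prems by auto
      then show ?thesis by (simp add: diff_degree_le_const)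
    next
      case (Suc k')
      with Suc.hyps(1)[of k' l] Suc.hyps(2) Suc.prems diff_degree_le_shift[of l g d]
      show ?thesis by simp
    qed
    have 2: "diff_degree_le n (\<lambda>x. f x * (g (x + d) - g x))"
    proof (cases l)
      case 0
      then obtain c where "\<And>x. g x = c" using Suc.prems by auto
      then show ?thesis by (simp add: diff_degree_le_const)
    next
      case (Suc l')
      with Suc.hyps(1)[of k l'] Suc.hyps(2) Suc.prems
      show ?thesis by simp
    qed
    from diff_degree_le_add[OF 1 2] show ?thesis by (simp add: algebra_simps)
  qed
  then show ?case unfolding Suc.hyps(2)[symmetric] by simp
qed

lemma diff_degree_le_prod:
  fixes f :: "'i \<Rightarrow> 'a::ab_group_add \<Rightarrow> 'b::comm_ring_1"
  assumes "\<And>i. i \<in> I \<Longrightarrow> diff_degree_le (g i) (f i)"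
  shows "diff_degree_le (\<Sum>i\<in>I. g i) (\<lambda>x. \<Prod>i\<in>I. f i x)"
  using assms
  by (induction I rule: infinite_finite_induct)
     (simp_all add: diff_degree_le_const diff_degree_le_mult del: diff_degree_le.simps)

lemma diff_degree_le_power:
  fixes f :: "'a::ab_group_add \<Rightarrow> 'b::comm_ring_1"
  assumes "diff_degree_le 1 f"
  shows "diff_degree_le n (\<lambda>x. f x ^ n)"
  using diff_degree_le_prod[of "{..<n}" "\<lambda>_. 1" "\<lambda>_. f", OF assms]
  by (simp del: diff_degree_le.simps)

lemma diff_degree_le_additive:
  assumes "\<And>x y. f (x + y) = f x + f y"
  shows "diff_degree_le 1 f"
  by (simp add: assms)

section \<open>Unisolvence of the Lagrange points of a simplex\<close>

text \<open>
  On the line through \<open>x\<close> in direction \<open>d\<close>, the function \<open>f - f x\<close> is a polynomial in one variable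
  that vanishes at all natural numbers.
\<close>

lemma periodic_polynomial_const_on_line:
  fixes f :: "'a::euclidean_space \<Rightarrow> real"
  assumes "real_polynomial_function f" and per: "\<And>x. f (x + d) = f x"
  shows "f (x + s *\<^sub>R d) = f x"
proof -
  let ?g = "\<lambda>s. f (x + s *\<^sub>R d) - f x"
  have "polynomial_function (\<lambda>s::real. x + s *\<^sub>R d)"
    by (intro polynomial_function_add polynomial_function_const polynomial_function_mult)
       (simp_all add: polynomial_function_id)
  from real_polynomial_function_compose[OF this assms(1)]
  have "real_polynomial_function ?g"
    by (auto simp: o_def)
  then obtain a n where g: "?g = (\<lambda>s. \<Sum>i\<le>n. a i * s ^ i)"
    unfolding real_polynomial_function_iff_sum by blast
  have "?g (real j) = 0" for j
  proof (induction j)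
    case (Suc j)
    then show ?case using per[of "x + real j *\<^sub>R d"] by (simp add: algebra_simps)
  qed simp
  then have "range real \<subseteq> {s. (\<Sum>i\<le>n. a i * s ^ i) = 0}"
    using g by (smt (verit) image_subset_iff mem_Collect_eq)
  then have "infinite {s. (\<Sum>i\<le>n. a i * s ^ i) = 0}"
    using finite_subset finite_imageD[of real UNIV] by (metis infinite_UNIV_nat inj_of_nat)
  then have "\<forall>i\<le>n. a i = 0" using polyfun_finite_roots by blast
  then have "?g s = 0" using fun_cong[OF g, of s] by simp
  then show ?thesis by simp
qed

text \<open>
  The induction is on the degree. The difference of \<open>f\<close> in a lattice direction \<open>d i\<close> has degree one
  less and vanishes on the lattice simplex of size \<open>k - 1\<close>, because both \<open>y\<close> and \<open>y + d i\<close> lie in the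
  simplex of size \<open>k\<close> for each of its points \<open>y\<close>. Hence \<open>f\<close> is periodic in every lattice direction,
  so constant along these directions, which span the space; and \<open>f v = 0\<close>.
\<close>

lemma polynomial_eq_0_on_lattice:
  fixes f :: "'a::euclidean_space \<Rightarrow> real" and d :: "'i \<Rightarrow> 'a"
  assumes "finite I" and span: "span (d ` I) = UNIV"
    and "real_polynomial_function f" and "diff_degree_le k f"
    and "\<And>m :: 'i \<Rightarrow> nat. (\<Sum>i\<in>I. m i) \<le> k \<Longrightarrow> f (v + (\<Sum>i\<in>I. real (m i) *\<^sub>R d i)) = 0"
  shows "f x = 0"
  using assms(3-5)
proof (induction k arbitrary: f x)
  case 0
  have "f v = 0" using "0.prems"(3)[of "\<lambda>_. 0"] by simp
  moreover obtain c where "\<And>x. f x = c" using "0.prems"(2) by auto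
  ultimately show ?case by simp
next
  case (Suc k)
  have per: "f (y + d i) = f y" if "i \<in> I" for i y
  proof -
    let ?g = "\<lambda>x. f (x + d i) - f x"
    have "polynomial_function (\<lambda>x. x + d i)"
      by (intro polynomial_function_add) (simp_all add: polynomial_function_id)
    from real_polynomial_function_compose[OF this Suc.prems(1)]
    have "real_polynomial_function ?g"
      using Suc.prems(1) by (auto simp: o_def)
    moreover have "diff_degree_le k ?g" using Suc.prems(2) by simp
    moreover have "?g (v + (\<Sum>j\<in>I. real (m j) *\<^sub>R d j)) = 0" if "sum m I \<le> k" for m
    proof -
      let ?m = "m(i := Suc (m i))"
      have I: "I = insert i (I - {i})" using \<open>i \<in> I\<close> by auto
      have rest: "sum ?m (I - {i}) = sum m (I - {i})"
        "(\<Sum>j\<in>I - {i}. real (?m j) *\<^sub>R d j) = (\<Sum>j\<in>I - {i}. real (m j) *\<^sub>R d j)"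
        by (auto intro: sum.cong)
      have "sum ?m I = Suc (sum m I)"
        using \<open>finite I\<close> \<open>i \<in> I\<close> rest(1) by (simp add: sum.remove[of I i])
      then have "f (v + (\<Sum>j\<in>I. real (?m j) *\<^sub>R d j)) = 0"
        using that by (intro Suc.prems(3)) simp
      moreover have "(\<Sum>j\<in>I. real (?m j) *\<^sub>R d j) = (\<Sum>j\<in>I. real (m j) *\<^sub>R d j) + d i"
        using \<open>finite I\<close> \<open>i \<in> I\<close> rest(2) by (simp add: sum.remove[of I i] algebra_simps)
      moreover have "f (v + (\<Sum>j\<in>I. real (m j) *\<^sub>R d j)) = 0"
        using that by (intro Suc.prems(3)) simp
      ultimately show ?thesis by (simp add: add.assoc)
    qed
    ultimately have "?g y = 0" by (rule Suc.IH)
    then show ?thesis by simp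
  qed
  have "\<forall>y. f (y + w) = f y" if "w \<in> span (d ` I)" for w
    using that
  proof (induction rule: span_induct_alt)
    case (step c b w)
    then obtain i where i: "i \<in> I" "b = d i" by auto
    show ?case
    proof
      fix y
      have "f (y + (c *\<^sub>R b + w)) = f ((y + w) + c *\<^sub>R d i)" by (simp add: i algebra_simps)
      also have "\<dots> = f (y + w)"
        by (rule periodic_polynomial_const_on_line[of f "d i", OF Suc.prems(1) per[OF i(1)]])
      also have "\<dots> = f y" using step by blast
      finally show "f (y + (c *\<^sub>R b + w)) = f y" .
    qed
  qed simp
  then have "f (v + (x - v)) = f v" using span by blast
  moreover have "f v = 0" using Suc.prems(3)[of "\<lambda>_. 0"] by simp
  ultimately show ?case by simp
qed

lemma span_simplex_edges:
  fixes C :: "'a::euclidean_space set"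
  assumes "\<not> affine_dependent C" "card C = DIM('a) + 1" "v \<in> C"
  shows "span ((\<lambda>w. w - v) ` (C - {v})) = UNIV"
proof -
  have fin: "finite C" using assms(1) aff_independent_finite by blast
  have "independent ((\<lambda>w. w - v) ` (C - {v}))"
    using assms(1,3) affine_dependent_iff_dependent2[of v C] by simp
  moreover have "card ((\<lambda>w. w - v) ` (C - {v})) = DIM('a)"
    using assms(2,3) fin by (subst card_image) (auto simp: inj_on_def)
  ultimately show ?thesis
    by (metis dim_eq_full dim_span_eq_card_independent dim_span)
qed

text \<open>
  Seen from one vertex \<open>v\<close>, the Lagrange points are the points of the lattice generated by the
  vectors \<open>(w - v) / k\<close> whose coefficients have sum at most \<open>k\<close>; the coefficient of \<open>v\<close> itself takes
  up what is missing to \<open>k\<close>.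
\<close>

lemma lagrange_unisolvence:
  fixes f :: "'a::euclidean_space \<Rightarrow> real"
  assumes C: "\<not> affine_dependent C" "card C = DIM('a) + 1" and "k \<ge> 1"
    and f: "real_polynomial_function f" "diff_degree_le k f"
    and zero: "\<And>m :: 'a \<Rightarrow> nat. (\<Sum>w\<in>C. m w) = k \<Longrightarrow> f (\<Sum>w\<in>C. (real (m w) / real k) *\<^sub>R w) = 0"
  shows "f x = 0"
proof -
  have fin: "finite C" using C(1) aff_independent_finite by blast
  obtain v where v: "v \<in> C" using C(2) by fastforce
  define d where "d = (\<lambda>w. (1 / real k) *\<^sub>R (w - v))"
  have "d ` (C - {v}) = (\<lambda>x. (1 / real k) *\<^sub>R x) ` ((\<lambda>w. w - v) ` (C - {v}))"
    by (auto simp: d_def)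
  then have span: "span (d ` (C - {v})) = UNIV"
    using span_image_scale[of "(\<lambda>w. w - v) ` (C - {v})" "\<lambda>_. 1 / real k"]
      span_simplex_edges[OF C v] \<open>k \<ge> 1\<close> fin by simp
  show ?thesis
  proof (rule polynomial_eq_0_on_lattice[OF _ span f, where v = v])
    show "finite (C - {v})" using fin by simp
  next
    fix m :: "'a \<Rightarrow> nat"
    let ?s = "\<Sum>w\<in>C - {v}. m w"
    assume s: "?s \<le> k"
    let ?m = "m(v := k - ?s)"
    have rest: "sum ?m (C - {v}) = ?s"
      "(\<Sum>w\<in>C - {v}. (real (?m w) / real k) *\<^sub>R w) = (\<Sum>w\<in>C - {v}. (real (m w) / real k) *\<^sub>R w)"
      by (auto intro: sum.cong)
    have "sum ?m C = k" using rest(1) s fin v by (simp add: sum.remove[of C v])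
    then have "f (\<Sum>w\<in>C. (real (?m w) / real k) *\<^sub>R w) = 0" by (rule zero)
    also have "(\<Sum>w\<in>C. (real (?m w) / real k) *\<^sub>R w)
        = (real (k - ?s) / real k) *\<^sub>R v + (\<Sum>w\<in>C - {v}. (real (m w) / real k) *\<^sub>R w)"
      using rest(2) fin v by (simp add: sum.remove[of C v])
    also have "\<dots> = v + (\<Sum>w\<in>C - {v}. real (m w) *\<^sub>R d w)"
    proof -
      have "(\<Sum>w\<in>C - {v}. real (m w) *\<^sub>R d w)
          = (\<Sum>w\<in>C - {v}. (real (m w) / real k) *\<^sub>R w) - (\<Sum>w\<in>C - {v}. (real (m w) / real k)) *\<^sub>R v"
        by (simp add: d_def algebra_simps sum_subtractf scaleR_sum_left)
      moreover have "(\<Sum>w\<in>C - {v}. (real (m w) / real k)) = real ?s / real k"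
        by (simp add: sum_divide_distrib)
      moreover have "real (k - ?s) / real k = 1 - real ?s / real k"
        using s \<open>k \<ge> 1\<close> by (simp add: of_nat_diff diff_divide_distrib)
      ultimately show ?thesis
        by (simp only: scaleR_left_diff_distrib scaleR_one) (simp only: algebra_simps)
    qed
    finally show "f (v + (\<Sum>w\<in>C - {v}. real (m w) *\<^sub>R d w)) = 0" .
  qed
qed

lemma matrix_polys_entry:
  fixes i j :: 3
  assumes "U \<in> matrix_polys k T"
  obtains p :: "real^3 \<Rightarrow> real" where "real_polynomial_function p" "diff_degree_le k p"
    "\<And>x. x \<in> T \<Longrightarrow> U x $ i $ j = p x"
proof -
  obtain C where C: "\<And>x. x \<in> T \<Longrightarrow>
     U x = (\<Sum>\<alpha> | (\<Sum>i\<in>UNIV. \<alpha> i) \<le> k. (\<Prod>i\<in>UNIV. x $ i ^ \<alpha> i) *\<^sub>R C \<alpha>)"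
    using assms unfolding matrix_polys_def by blast
  define p where "p = (\<lambda>x::real^3. \<Sum>\<alpha> | (\<Sum>i\<in>UNIV. \<alpha> i) \<le> k. (\<Prod>i\<in>UNIV. x $ i ^ \<alpha> i) * C \<alpha> $ i $ j)"
  show thesis
  proof (rule that)
    have coord: "real_polynomial_function (\<lambda>x::real^3. x $ l)" for l
      by (intro real_polynomial_function.intros(1) bounded_linear_vec_nth)
    show "real_polynomial_function p"
      unfolding p_def
      by (intro real_polynomial_function_sum real_polynomial_function.intros real_polynomial_function_prod
           real_polynomial_function_power coord finite_multi_indices) auto
    show "diff_degree_le k p"
      unfolding p_def
    proof (rule diff_degree_le_sum)
      fix \<alpha> :: "3 \<Rightarrow> nat"
      assume \<alpha>: "\<alpha> \<in> {\<alpha>. (\<Sum>i\<in>UNIV. \<alpha> i) \<le> k}"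
      have "diff_degree_le (\<alpha> l) (\<lambda>x::real^3. x $ l ^ \<alpha> l)" for l
        by (rule diff_degree_le_power, rule diff_degree_le_additive) simp
      then have "diff_degree_le ((\<Sum>l\<in>UNIV. \<alpha> l) + 0) (\<lambda>x::real^3. (\<Prod>l\<in>UNIV. x $ l ^ \<alpha> l) * C \<alpha> $ i $ j)"
        by (intro diff_degree_le_mult diff_degree_le_prod diff_degree_le_const)
      then show "diff_degree_le k (\<lambda>x::real^3. (\<Prod>l\<in>UNIV. x $ l ^ \<alpha> l) * C \<alpha> $ i $ j)"
        using \<alpha> diff_degree_le_mono by fastforce
    qed
    show "U x $ i $ j = p x" if "x \<in> T" for x
      by (simp add: C[OF that] p_def)
  qed
qed

section \<open>Matrices determined by the functionals at one point\<close>

lemma eq_0_if_orthogonal_span: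
  fixes x :: "'a::euclidean_space"
  assumes "span S = UNIV" "\<And>v. v \<in> S \<Longrightarrow> x \<bullet> v = 0"
  shows "x = 0"
  using orthogonal_to_span[of x S x] assms by (auto simp: orthogonal_def)

text \<open>
  Both kinds of local computation end here, with \<open>w\<close> the normal of a face or the tangent of an edge.
  A row \<open>r\<close> of \<open>A\<close> satisfies \<open>(r \<times> w) \<bullet> a = r \<bullet> (w \<times> a) = 0\<close>, likewise for \<open>b\<close>, and \<open>r \<times> w\<close> is
  orthogonal to \<open>w\<close>. So \<open>r \<times> w = 0\<close>, while also \<open>r \<bullet> w = 0\<close>.
\<close>

lemma matrix_eq_0_if_kills_cross_frame:
  fixes A :: "real^3^3"
  assumes frame: "\<And>x. x \<bullet> w = 0 \<Longrightarrow> x \<bullet> a = 0 \<Longrightarrow> x \<bullet> b = 0 \<Longrightarrow> x = 0"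
    and "w \<noteq> 0" and A: "A *v w = 0" "A *v cross3 w a = 0" "A *v cross3 w b = 0"
  shows "A = 0"
proof -
  have "A $ i = 0" for i
  proof -
    let ?r = "A $ i"
    have row: "?r \<bullet> v = 0" if "A *v v = 0" for v
      using that by (metis matrix_vector_mul_component zero_index)
    have "cross3 ?r w = 0"
    proof (rule frame)
      have "cross3 ?r w \<bullet> v = ?r \<bullet> cross3 w v" for v by (simp add: cross3_simps)
      then show "cross3 ?r w \<bullet> w = 0" "cross3 ?r w \<bullet> a = 0" "cross3 ?r w \<bullet> b = 0"
        using A row by simp_all
    qed
    with row[OF A(1)] \<open>w \<noteq> 0\<close> norm_and_cross_eq_0[of ?r w] show ?thesis by blast
  qed
  then show ?thesis by (simp add: vec_eq_iff)
qed

text \<open>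
  Sum and difference of the two mixed functionals vanish, so both do separately. Then
  \<open>A (n \<times> a1)\<close>, \<open>A (n \<times> a2)\<close> and \<open>A n\<close> are each orthogonal to the whole frame \<open>a1, a2, n\<close>.
\<close>

lemma face_point_determined:
  fixes A :: "real^3^3"
  assumes "norm n = 1" and frame: "face_frame a1 a2 n"
    and "bil a1 A (cross3 n a1) = 0" "bil a2 A (cross3 n a2) = 0"
    and "bil a1 A (cross3 n a2) + bil a2 A (cross3 n a1) = 0"
    and "bil n A (cross3 n a1) = 0" "bil n A (cross3 n a2) = 0"
    and "bil a1 A (cross3 n a2) - bil a2 A (cross3 n a1) = 0"
    and "bil a1 A n = 0" "bil a2 A n = 0" "bil n A n = 0"
  shows "A = 0"
proof -
  have "independent {a1, a2, n}" "card {a1, a2, n} = 3"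
    using frame by (auto simp: face_frame_def)
  then have "span {a1, a2, n} = UNIV"
    using dim_eq_full[of "{a1, a2, n}"] dim_eq_card_independent[of "{a1, a2, n}"] by simp
  then have frame': "x = 0" if "x \<bullet> n = 0" "x \<bullet> a1 = 0" "x \<bullet> a2 = 0" for x
    using that by (intro eq_0_if_orthogonal_span[of "{a1, a2, n}"]) auto
  show ?thesis
  proof (rule matrix_eq_0_if_kills_cross_frame[of n a1 a2])
    show "n \<noteq> 0" using assms(1) by auto
    show "A *v n = 0" "A *v cross3 n a1 = 0" "A *v cross3 n a2 = 0"
      using assms(3-) by (auto intro!: frame' simp: bil_def inner_commute)
  qed (rule frame')
qed

text \<open>
  Since \<open>p \<times> q\<close> is parallel to \<open>t\<close>, a vector orthogonal to \<open>t\<close>, \<open>p\<close> and \<open>q\<close> is both orthogonal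
  and parallel to \<open>p \<times> q\<close>.
\<close>

lemma edge_frame:
  fixes x t p q :: "real^3"
  assumes "t \<bullet> p = 0" "t \<bullet> q = 0" "t \<noteq> 0" and pq: "cross3 p q \<noteq> 0"
    and "x \<bullet> t = 0" "x \<bullet> p = 0" "x \<bullet> q = 0"
  shows "x = 0"
proof -
  let ?w = "cross3 p q"
  have double: "cross3 y ?w = (y \<bullet> q) *\<^sub>R p - (y \<bullet> p) *\<^sub>R q" for y
    by (simp add: cross3_simps forall_3)
  have "cross3 t ?w = 0" "cross3 x ?w = 0" using assms by (simp_all add: double)
  then have "t \<bullet> ?w \<noteq> 0" using norm_and_cross_eq_0 \<open>t \<noteq> 0\<close> pq by blast
  moreover have "(a \<bullet> c) * (b \<bullet> c) = (a \<bullet> b) * (c \<bullet> c) - cross3 a c \<bullet> cross3 b c"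
    for a b c :: "real^3" by (simp add: cross3_simps)
  from this[of x ?w t] have "(x \<bullet> ?w) * (t \<bullet> ?w) = 0"
    using \<open>cross3 x ?w = 0\<close> \<open>x \<bullet> t = 0\<close> by simp
  ultimately have "x \<bullet> ?w = 0" by simp
  then show ?thesis using \<open>cross3 x ?w = 0\<close> norm_and_cross_eq_0 pq by blast
qed

text \<open>
  Here \<open>p\<close> and \<open>q\<close> are the normals of the two faces that meet in an edge with tangent \<open>t\<close>. The
  functionals that multiply by \<open>t\<close> from the right give \<open>A t = 0\<close>. For each of the normals \<open>n\<close>, the
  identity \<open>n \<times> (t \<times> n) = t\<close> turns the sum of two terms into \<open>t\<^sup>T A t\<close>, known to vanish, plus
  \<open>(t \<times> n)\<^sup>T A (n \<times> t)\<close>. So \<open>A (n \<times> t)\<close> is orthogonal to \<open>t\<close>, \<open>n\<close> and \<open>t \<times> n\<close>.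
\<close>

lemma edge_point_determined:
  fixes A :: "real^3^3"
  assumes t: "norm t = 1" and unit: "norm p = 1" "norm q = 1"
    and orth: "t \<bullet> p = 0" "t \<bullet> q = 0" and pq: "cross3 p q \<noteq> 0"
    and span: "p \<in> span {m1, m2}" "q \<in> span {m1, m2}"
    and m: "bil m1 A t = 0" "bil m2 A t = 0" and tt: "bil t A t = 0"
    and b: "\<And>n. n \<in> {p, q} \<Longrightarrow> bil t A (cross3 n t) = 0"
      "\<And>n. n \<in> {p, q} \<Longrightarrow> bil n A (cross3 n t) = 0"
      "\<And>n. n \<in> {p, q} \<Longrightarrow>
        bil t A (cross3 n (conormal t n)) + bil (conormal t n) A (cross3 n t) = 0"
  shows "A = 0"
proof -
  have t0: "t \<noteq> 0" using t by auto
  note frame = edge_frame[OF orth t0 pq]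
  have "A *v t = 0"
  proof (rule frame)
    have "orthogonal (A *v t) v" if "v \<in> span {m1, m2}" for v
      using that
    proof (rule orthogonal_to_span)
      show "orthogonal (A *v t) u" if "u \<in> {m1, m2}" for u
        using that m by (auto simp: orthogonal_def bil_def inner_commute)
    qed
    then show "(A *v t) \<bullet> p = 0" "(A *v t) \<bullet> q = 0" using span by (auto simp: orthogonal_def)
    show "(A *v t) \<bullet> t = 0" using tt by (simp add: bil_def inner_commute)
  qed
  moreover have "A *v cross3 t n = 0" if n: "n \<in> {p, q}" for n
  proof -
    let ?y = "A *v cross3 n t"
    have nn: "norm n = 1" "t \<bullet> n = 0" using n unit orth by auto
    have "cross3 n (conormal t n) = (n \<bullet> n) *\<^sub>R t - (t \<bullet> n) *\<^sub>R n"
      by (simp add: conormal_def cross3_simps forall_3)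
    then have "cross3 n (conormal t n) = t" using nn by (simp add: norm_eq_1)
    with b(3)[OF n] tt have y: "?y \<bullet> cross3 t n = 0"
      by (simp add: bil_def conormal_def inner_commute)
    have "cross3 ?y (cross3 t n) = (?y \<bullet> n) *\<^sub>R t - (?y \<bullet> t) *\<^sub>R n"
      by (simp add: cross3_simps forall_3)
    also have "\<dots> = 0" using b(1,2)[OF n] by (simp add: bil_def inner_commute)
    finally have "?y = 0 \<or> cross3 t n = 0" using y norm_and_cross_eq_0 by blast
    moreover have "cross3 t n \<noteq> 0"
      using nn t norm_and_cross_eq_0[of t n] by auto
    ultimately have "?y = 0" by blast
    then have "A *v (- cross3 n t) = 0"
      by (subst linear_neg[OF matrix_vector_mul_linear]) simp
    then show ?thesis by (subst cross_skew)
  qed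
  ultimately show ?thesis
    by (intro matrix_eq_0_if_kills_cross_frame[of t p q] frame t0) auto
qed

section \<open>Vanishing at the Lagrange points of a tetrahedron\<close>

text \<open>
  The facets opposite \<open>p\<close> and \<open>q\<close> share a vertex \<open>v\<close> and together contain all vertices. A vector normal
  to both would be orthogonal to every \<open>y - v\<close> with \<open>y\<close> a vertex, hence zero.
\<close>

lemma facet_normals_not_parallel:
  fixes C :: "(real^3) set"
  assumes C: "\<not> affine_dependent C" "card C = 4" and pq: "p \<in> C" "q \<in> C" "p \<noteq> q"
    and u: "unit_normal (convex hull (C - {p})) u" and w: "unit_normal (convex hull (C - {q})) w"
  shows "cross3 u w \<noteq> 0"
proof
  assume "cross3 u w = 0"
  moreover have nz: "u \<noteq> 0" "w \<noteq> 0" using u w by (auto simp: unit_normal_def)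
  ultimately obtain c where c: "w = c *\<^sub>R u"
    by (auto simp: cross_eq_0 collinear_lemma)
  with nz have "c \<noteq> 0" by auto
  have "C - {p, q} \<noteq> {}"
    using C(2) card_mono[of "{p, q}" C] pq(3) by (auto simp: card_insert_if)
  then obtain v where v: "v \<in> C" "v \<noteq> p" "v \<noteq> q" by blast
  have "u \<bullet> x = 0" if x: "x \<in> (\<lambda>y. y - v) ` (C - {v})" for x
  proof -
    obtain y where y: "y \<in> C" "x = y - v" using x by blast
    show ?thesis
    proof (cases "y = p")
      case True
      then have "w \<bullet> (y - v) = 0"
        using w v pq hull_inc[of _ "C - {q}" convex] by (auto simp: unit_normal_def)
      then show ?thesis using c \<open>c \<noteq> 0\<close> y by simp
    next
      case False
      then show ?thesis
        using u v y hull_inc[of _ "C - {p}" convex] by (auto simp: unit_normal_def)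
    qed
  qed
  moreover have "span ((\<lambda>y. y - v) ` (C - {v})) = UNIV"
    using C v(1) by (intro span_simplex_edges) simp_all
  ultimately have "u = 0" by (rule eq_0_if_orthogonal_span[rotated])
  with nz show False by blast
qed

text \<open>
  The vertices with positive coefficient span the face in whose relative interior the point lies.
  Their coefficients are positive integers of sum \<open>k\<close>, so there are at most \<open>k\<close> of them. This is
  why a face with \<open>j\<close> vertices contributes functionals only from \<open>k = j\<close> on.
\<close>

lemma lagrange_point_support:
  fixes C :: "'a::euclidean_space set" and m :: "'a \<Rightarrow> nat"
  assumes C: "\<not> affine_dependent C" and "k \<ge> 1" and m: "(\<Sum>w\<in>C. m w) = k"
  obtains S where "S \<subseteq> C" "S \<noteq> {}" "card S \<le> k"
    "(\<Sum>w\<in>C. (real (m w) / real k) *\<^sub>R w) \<in> rel_interior (convex hull S)"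
proof -
  define S where "S = {w \<in> C. m w > 0}"
  have fin: "finite C" using C aff_independent_finite by blast
  have sum_S: "(\<Sum>w\<in>S. m w) = k"
    unfolding m[symmetric] using fin by (intro sum.mono_neutral_left) (auto simp: S_def)
  show thesis
  proof (rule that)
    show S: "S \<subseteq> C" by (auto simp: S_def)
    show "S \<noteq> {}" using sum_S \<open>k \<ge> 1\<close> by auto
    have "(\<Sum>w\<in>S. 1) \<le> (\<Sum>w\<in>S. m w)" by (rule sum_mono) (auto simp: S_def)
    then show "card S \<le> k" using sum_S by simp
    have "(\<Sum>w\<in>C. (real (m w) / real k) *\<^sub>R w) = (\<Sum>w\<in>S. (real (m w) / real k) *\<^sub>R w)"
      using fin by (intro sum.mono_neutral_right) (auto simp: S_def)
    moreover have "(\<Sum>w\<in>S. real (m w) / real k) = 1"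
      using sum_S \<open>k \<ge> 1\<close> by (simp flip: sum_divide_distrib of_nat_sum)
    moreover have "\<forall>w\<in>S. 0 < real (m w) / real k" using \<open>k \<ge> 1\<close> by (simp add: S_def)
    moreover have "\<not> affine_dependent S" using C S affine_dependent_subset by blast
    ultimately show "(\<Sum>w\<in>C. (real (m w) / real k) *\<^sub>R w) \<in> rel_interior (convex hull S)"
      by (auto simp: rel_interior_convex_hull_explicit)
  qed
qed

lemma vertex_value_eq_0:
  assumes dofs: "\<forall>l\<in>vertex_dofs T. l U = 0" and "V extreme_point_of T"
  shows "U V = 0"
proof -
  have V: "V \<in> {V. V extreme_point_of T}" using assms(2) by simp
  have off: "U V $ i $ j = 0" if "i \<noteq> j" for i j
  proof -
    have "(\<lambda>U. U V $ i $ j) \<in> vertex_dofs T"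
      unfolding vertex_dofs_def by (rule UN_I[OF V]) (use that in blast)
    from bspec[OF dofs this] show ?thesis .
  qed
  have mem: "(\<lambda>U. U V $ 1 $ 1 - U V $ 2 $ 2) \<in> vertex_dofs T"
    "(\<lambda>U. U V $ 2 $ 2 - U V $ 3 $ 3) \<in> vertex_dofs T"
    "(\<lambda>U. U V $ 1 $ 1 + U V $ 2 $ 2 + U V $ 3 $ 3) \<in> vertex_dofs T"
    unfolding vertex_dofs_def by (rule UN_I[OF V], blast)+
  have diag: "U V $ 1 $ 1 - U V $ 2 $ 2 = 0" "U V $ 2 $ 2 - U V $ 3 $ 3 = 0"
      "U V $ 1 $ 1 + U V $ 2 $ 2 + U V $ 3 $ 3 = 0"
    using mem[THEN bspec[OF dofs]] .
  have "U V $ i $ i = 0" for i using diag exhaust_3[of i] by auto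
  with off have "U V $ i $ j = 0" for i j by (cases "i = j") auto
  then show ?thesis by (simp add: vec_eq_iff)
qed

lemma edge_value_eq_0:
  fixes C :: "(real^3) set"
  assumes C: "\<not> affine_dependent C" "card C = 4" and T: "T = convex hull C"
    and n: "\<And>F. F facet_of T \<Longrightarrow> unit_normal F (n F)"
    and t: "\<And>E. E edge_of T \<Longrightarrow> unit_tangent E (t E)"
    and m: "\<And>E. E edge_of T \<Longrightarrow> edge_normals E (m1 E) (m2 E)"
    and dofs: "\<forall>l\<in>edge_dofs k T n t m1 m2. l U = 0" and "k \<ge> 2"
    and S: "S \<subseteq> C" "card S = 2" and L: "L \<in> inner_lagrange_points k T (convex hull S)"
  shows "U L = 0"
proof -
  let ?E = "convex hull S"
  have fin: "finite C" using C aff_independent_finite by blast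
  have "\<not> affine_dependent S" using C(1) S(1) affine_dependent_subset by blast
  then have E: "?E edge_of T"
    using C(1) S T face_of_convex_hull_affine_independent[OF C(1)] aff_dim_affine_independent[of S]
    by (auto simp: edge_of_def aff_dim_convex_hull)
  have "card (C - S) = 2" using S C(2) fin by (simp add: card_Diff_subset finite_subset)
  then obtain p q where pq: "C - S = {p, q}" "p \<noteq> q" by (auto simp: card_2_iff)
  let ?F = "\<lambda>v. convex hull (C - {v})"
  have pqC: "p \<in> C" "q \<in> C" using pq(1) by blast+
  have F: "?F v facet_of T" "?E \<subseteq> ?F v" if "v \<in> {p, q}" for v
  proof -
    show "?F v facet_of T"
      unfolding T facet_of_convex_hull_affine_independent_alt[OF C(1)] using C(2) pqC that by auto
    show "?E \<subseteq> ?F v" using S(1) pq(1) that by (intro hull_mono) blast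
  qed
  let ?tangential = "\<lambda>F. {\<lambda>U. bil (t ?E) (U L) (cross3 (n F) (t ?E)),
    \<lambda>U. bil (n F) (U L) (cross3 (n F) (t ?E)),
    \<lambda>U. bil (t ?E) (U L) (cross3 (n F) (conormal (t ?E) (n F)))
       + bil (conormal (t ?E) (n F)) (U L) (cross3 (n F) (t ?E))}"
  have all: "\<forall>l\<in>{\<lambda>U. bil (m1 ?E) (U L) (t ?E), \<lambda>U. bil (m2 ?E) (U L) (t ?E)}
      \<union> (\<Union>F\<in>{F. F facet_of T \<and> ?E \<subseteq> F}. ?tangential F)
      \<union> {\<lambda>U. bil (t ?E) (U L) (t ?E)}. l U = 0"
    using dofs E L \<open>k \<ge> 2\<close> unfolding edge_dofs_def by fastforce
  then have d: "bil (m1 ?E) (U L) (t ?E) = 0" "bil (m2 ?E) (U L) (t ?E) = 0"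
      "bil (t ?E) (U L) (t ?E) = 0"
    by (simp_all add: ball_Un)
  have "\<forall>l\<in>?tangential (?F v). l U = 0" if "v \<in> {p, q}" for v
  proof
    fix l assume l: "l \<in> ?tangential (?F v)"
    show "l U = 0"
      by (rule bspec[OF all], rule UnI1, rule UnI2, rule UN_I[where a = "?F v"])
         (use F[OF that] l in simp_all)
  qed
  then have dF: "bil (t ?E) (U L) (cross3 (n (?F v)) (t ?E)) = 0"
      "bil (n (?F v)) (U L) (cross3 (n (?F v)) (t ?E)) = 0"
      "bil (t ?E) (U L) (cross3 (n (?F v)) (conormal (t ?E) (n (?F v))))
         + bil (conormal (t ?E) (n (?F v))) (U L) (cross3 (n (?F v)) (t ?E)) = 0"
    if "v \<in> {p, q}" for v
    using that by (simp_all del: insert_iff)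
  have perp: "n (?F v) \<bullet> (x - y) = 0" if "v \<in> {p, q}" "x \<in> ?E" "y \<in> ?E" for v x y
    using n[OF F(1)[OF that(1)]] F(2)[OF that(1)] that unfolding unit_normal_def by blast
  have unit: "norm (n (?F v)) = 1" if "v \<in> {p, q}" for v
    using n[OF F(1)[OF that]] unfolding unit_normal_def by blast
  have t_perp: "t ?E \<bullet> n (?F v) = 0" if "v \<in> {p, q}" for v
  proof -
    obtain x y c where "x \<in> ?E" "y \<in> ?E" "t ?E = c *\<^sub>R (x - y)"
      using t[OF E] unfolding unit_tangent_def by blast
    then show ?thesis using perp[OF that] by (simp add: inner_commute)
  qed
  have in_span: "n (?F v) \<in> span {m1 ?E, m2 ?E}" if "v \<in> {p, q}" for v
    using m[OF E] perp[OF that] unfolding edge_normals_def by blast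
  have unit_t: "norm (t ?E) = 1" using t[OF E] unfolding unit_tangent_def by blast
  have "cross3 (n (?F p)) (n (?F q)) \<noteq> 0"
    using facet_normals_not_parallel[OF C pqC pq(2)] n F(1) by blast
  note determined = edge_point_determined[OF unit_t unit[of p] unit[of q] t_perp[of p] t_perp[of q]
      this in_span[of p] in_span[of q] d]
  show ?thesis
    by (rule determined) (use dF in auto)
qed

lemma face_value_eq_0:
  fixes C :: "(real^3) set"
  assumes C: "\<not> affine_dependent C" "card C = 4" and T: "T = convex hull C"
    and n: "\<And>F. F facet_of T \<Longrightarrow> unit_normal F (n F)"
    and a: "\<And>F. F facet_of T \<Longrightarrow> face_frame (a1 F) (a2 F) (n F)"
    and dofs: "\<forall>l\<in>face_dofs k T n a1 a2. l U = 0" and "k \<ge> 3"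
    and S: "S \<subseteq> C" "card S = 3" and L: "L \<in> inner_lagrange_points k T (convex hull S)"
  shows "U L = 0"
proof -
  let ?F = "convex hull S"
  have fin: "finite C" using C aff_independent_finite by blast
  have "card (C - S) = 1" using S C(2) fin by (simp add: card_Diff_subset finite_subset)
  then obtain p where "C - S = {p}" by (auto simp: card_1_singleton_iff)
  with S(1) have "p \<in> C" "S = C - {p}" by blast+
  then have F: "?F facet_of T"
    unfolding T facet_of_convex_hull_affine_independent_alt[OF C(1)] using C(2) by auto
  have "\<forall>l\<in>{\<lambda>U. bil (a1 ?F) (U L) (cross3 (n ?F) (a1 ?F)),
           \<lambda>U. bil (a2 ?F) (U L) (cross3 (n ?F) (a2 ?F)),
           \<lambda>U. bil (a1 ?F) (U L) (cross3 (n ?F) (a2 ?F)) + bil (a2 ?F) (U L) (cross3 (n ?F) (a1 ?F)),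
           \<lambda>U. bil (n ?F) (U L) (cross3 (n ?F) (a1 ?F)),
           \<lambda>U. bil (n ?F) (U L) (cross3 (n ?F) (a2 ?F))}
          \<union>
          {\<lambda>U. bil (a1 ?F) (U L) (cross3 (n ?F) (a2 ?F)) - bil (a2 ?F) (U L) (cross3 (n ?F) (a1 ?F)),
           \<lambda>U. bil (a1 ?F) (U L) (n ?F),
           \<lambda>U. bil (a2 ?F) (U L) (n ?F),
           \<lambda>U. bil (n ?F) (U L) (n ?F)}. l U = 0"
    using dofs F L \<open>k \<ge> 3\<close> unfolding face_dofs_def by fastforce
  then show ?thesis
    using n[OF F] by (intro face_point_determined[OF _ a[OF F]]) (auto simp: unit_normal_def)
qed

lemma interior_value_eq_0:
  assumes "\<forall>l\<in>interior_dofs k T. l U = 0" "k \<ge> 4" "L \<in> inner_lagrange_points k T T"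
  shows "U L = 0"
proof -
  have "\<forall>l\<in>{\<lambda>U. U L $ i $ j | i j. True}. l U = 0"
    using assms unfolding interior_dofs_def by fastforce
  then have "(\<lambda>U. U L $ i $ j) U = 0" for i j by (rule bspec) blast
  then show ?thesis by (simp add: vec_eq_iff)
qed

theorem theorem9:
  fixes T :: "(real^3) set" and k :: nat and U :: "real^3 \<Rightarrow> real^3^3"
    and n a1 a2 t m1 m2 :: "(real^3) set \<Rightarrow> real^3"
  assumes "3 simplex T"
    and "k \<ge> 1"
    and "\<And>F. F facet_of T \<Longrightarrow> unit_normal F (n F)"
    and "\<And>F. F facet_of T \<Longrightarrow> face_frame (a1 F) (a2 F) (n F)"
    and "\<And>E. E edge_of T \<Longrightarrow> unit_tangent E (t E)"
    and "\<And>E. E edge_of T \<Longrightarrow> edge_normals E (m1 E) (m2 E)"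
    and "U \<in> matrix_polys k T"
    and "\<And>l. l \<in> symcurl_dofs k T n a1 a2 t m1 m2 \<Longrightarrow> l U = 0"
  shows "\<forall>x\<in>T. U x = 0"
proof -
  obtain C where C: "\<not> affine_dependent C" "card C = 4" and T: "T = convex hull C"
    using assms(1) by (auto simp: simplex_def)
  have fin: "finite C" using C(1) aff_independent_finite by blast
  have ext: "{V. V extreme_point_of T} = C"
    unfolding T using extreme_point_of_convex_hull_affine_independent[OF C(1)] by blast
  have dofs: "\<forall>l\<in>vertex_dofs T. l U = 0" "\<forall>l\<in>edge_dofs k T n t m1 m2. l U = 0"
    "\<forall>l\<in>face_dofs k T n a1 a2. l U = 0" "\<forall>l\<in>interior_dofs k T. l U = 0"
    using assms(8) by (auto simp: symcurl_dofs_def)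
  have lagrange_zero: "L \<in> T \<and> U L = 0"
    if m: "(\<Sum>w\<in>C. m w) = k" and L: "L = (\<Sum>w\<in>C. (real (m w) / real k) *\<^sub>R w)" for m L
  proof -
    have "(\<Sum>w\<in>C. real (m w) / real k) = 1"
      using m \<open>k \<ge> 1\<close> by (simp flip: sum_divide_distrib of_nat_sum)
    then have L_lagrange: "L \<in> lagrange_points k T"
      unfolding lagrange_points_def ext L by blast
    obtain S where S: "S \<subseteq> C" "S \<noteq> {}" "card S \<le> k" and LS: "L \<in> rel_interior (convex hull S)"
      using lagrange_point_support[OF C(1) \<open>k \<ge> 1\<close> m] unfolding L by blast
    have L_inner: "L \<in> inner_lagrange_points k T (convex hull S)"
      using L_lagrange LS by (simp add: inner_lagrange_points_def)
    have "L \<in> T"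
      using LS rel_interior_subset hull_mono[OF S(1), of convex] unfolding T by blast
    moreover have "card S \<noteq> 0" "card S \<le> 4"
      using S C(2) fin card_mono[OF fin S(1)] by (auto simp: finite_subset)
    then consider "card S = 1" | "card S = 2" | "card S = 3" | "card S = 4" by linarith
    then have "U L = 0"
    proof cases
      case 1
      then obtain V where V: "S = {V}" by (auto simp: card_1_singleton_iff)
      then have "L = V" "V extreme_point_of T" using LS S(1) ext by auto
      then show ?thesis using vertex_value_eq_0 dofs(1) by blast
    next
      case 2
      with S(3) show ?thesis
        by (intro edge_value_eq_0[OF C T assms(3,5,6) dofs(2) _ S(1) _ L_inner]) auto
    next
      case 3
      with S(3) show ?thesis
        by (intro face_value_eq_0[OF C T assms(3,4) dofs(3) _ S(1) _ L_inner]) auto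
    next
      case 4
      then have "S = C" using S(1) C(2) fin by (simp add: card_subset_eq)
      with 4 S(3) L_inner show ?thesis
        by (intro interior_value_eq_0[OF dofs(4)]) (auto simp: T)
    qed
    ultimately show ?thesis by blast
  qed
  show ?thesis
  proof
    fix x assume "x \<in> T"
    have "U x $ i $ j = 0" for i j
    proof -
      obtain p where p: "real_polynomial_function p" "diff_degree_le k p"
        and Up: "\<And>x. x \<in> T \<Longrightarrow> U x $ i $ j = p x"
        using matrix_polys_entry[OF assms(7)] by blast
      have "p x = 0"
      proof (rule lagrange_unisolvence[OF C(1) _ \<open>k \<ge> 1\<close> p])
        show "card C = DIM(real^3) + 1" using C(2) by simp
        show "p (\<Sum>w\<in>C. (real (m w) / real k) *\<^sub>R w) = 0" if "(\<Sum>w\<in>C. m w) = k" for m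
          using lagrange_zero[OF that refl] Up by fastforce
      qed
      with Up \<open>x \<in> T\<close> show ?thesis by simp
    qed
    then show "U x = 0" by (simp add: vec_eq_iff)
  qed
qed

end
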